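(* Let $\mathcal V$ be a $\mathsf{VS}$ $n$-groupoid of order $n$ and let $\mathcal W$ be a $\mathsf{VS}$ $m$-groupoid of order $m$. Then $\mathcal V\otimes\mathcal W$ has order at least $n+m$ and homotopy type at most $n+m$.
   Context: Vector spaces are finite-dimensional over $\mathbb R$; a simplicial vector space is a simplicial object in vector spaces (faces $d_i$, degeneracies $s_j$). $\mathcal V\otimes\mathcal W$ is the levelwise tensor product. For $l\ge1$, $0\le k\le l$, $\Lambda^l_k(\mathcal V)$ is the space of tuples $(x_0,\dots,\widehat{x_k},\dots,x_l)$ in $\mathcal V_{l-1}$ with $d_ix_j=d_{j-1}x_i$ for $i<j$, $i,j\ne k$, and $p^l_k:\mathcal V_l\to\Lambda^l_k(\mathcal V)$ is $x\mapsto(d_ix)_{i\neq k}$. A $\mathsf{VS}$ $n$-groupoid is a simplicial vector space such that $p^l_k$ is surjective for all $l\ge1$, $0\le k\le l$, and bijective for all $l\ge n+1$, $0\le k\le l$. Normalized complex: $N(\mathcal V)_l=\ker p^l_l=\bigcap_{i=0}^{l-1}\ker d_i^l$ (with $N(\mathcal V)_0=\mathcal V_0$) and differential $(-1)^ld_l^l$. The order of $\mathcal V$ is the maximal degree in which $N(\mathcal V)$ is nonzero ("order at least $r$" means $N(\mathcal V)_l\ne0$ for some $l\ge r$). The homotopy type of $\mathcal V$ is the maximal degree in which the homology of $N(\mathcal V)$ is nonzero; "homotopy type at most $r$" means $H_l(N(\mathcal V))=0$ for all $l>r$. *)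

theory Defs
  imports "HOL-Analysis.Analysis" "HOL-Analysis.Finite_Function_Topology"
begin

section \<open>Tensor product of real vector spaces\<close>

text \<open>The quotient of the free vector space on \<open>'a \<times> 'b\<close> by the bilinearity relations.\<close>

abbreviation free_gen :: "'a \<Rightarrow> 'b \<Rightarrow> ('a \<times> 'b) \<Rightarrow>\<^sub>0 real"
  where "free_gen x y \<equiv> Poly_Mapping.single (x, y) 1"

definition tensor_relations ::
    "(('a::real_vector \<times> 'b::real_vector) \<Rightarrow>\<^sub>0 real) set"
  where "tensor_relations =
      {free_gen (x + x') y - free_gen x y - free_gen x' y | x x' y. True}
    \<union> {free_gen x (y + y') - free_gen x y - free_gen x y' | x y y'. True}
    \<union> {free_gen (c *\<^sub>R x) y - c *\<^sub>R free_gen x y | c x y. True}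
    \<union> {free_gen x (c *\<^sub>R y) - c *\<^sub>R free_gen x y | c x y. True}"

lemma equivp_tensor_relations:
  "equivp (\<lambda>F G. F - G \<in> span (tensor_relations :: (('a::real_vector \<times> 'b::real_vector) \<Rightarrow>\<^sub>0 real) set))"
proof (rule equivpI)
  show "reflp (\<lambda>F G. F - G \<in> span (tensor_relations :: ('a \<times> 'b \<Rightarrow>\<^sub>0 real) set))"
    by (simp add: reflp_def span_zero)
  show "symp (\<lambda>F G. F - G \<in> span (tensor_relations :: ('a \<times> 'b \<Rightarrow>\<^sub>0 real) set))"
    by (metis (no_types, lifting) minus_diff_eq span_neg sympI)
  show "transp (\<lambda>F G. F - G \<in> span (tensor_relations :: ('a \<times> 'b \<Rightarrow>\<^sub>0 real) set))"
  proof (rule transpI)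
    fix F G H :: "'a \<times> 'b \<Rightarrow>\<^sub>0 real"
    assume "F - G \<in> span tensor_relations" "G - H \<in> span tensor_relations"
    then have "(F - G) + (G - H) \<in> span tensor_relations" by (rule span_add)
    then show "F - H \<in> span tensor_relations" by simp
  qed
qed

quotient_type (overloaded) ('a, 'b) tensor =
    "('a::real_vector \<times> 'b::real_vector) \<Rightarrow>\<^sub>0 real" /
    "\<lambda>F G. F - G \<in> span tensor_relations"
  by (rule equivp_tensor_relations)

instantiation tensor :: (real_vector, real_vector) real_vector
begin

lift_definition zero_tensor :: "('a, 'b) tensor" is 0 .

lift_definition plus_tensor :: "('a, 'b) tensor \<Rightarrow> ('a, 'b) tensor \<Rightarrow> ('a, 'b) tensor"
  is "(+)"
  by (metis (no_types, lifting) add_diff_add span_add)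

lift_definition uminus_tensor :: "('a, 'b) tensor \<Rightarrow> ('a, 'b) tensor"
  is uminus
  by (metis (no_types, lifting) minus_diff_minus span_neg)

lift_definition minus_tensor :: "('a, 'b) tensor \<Rightarrow> ('a, 'b) tensor \<Rightarrow> ('a, 'b) tensor"
  is "(-)"
proof -
  fix F F' G G' :: "('a \<times> 'b) \<Rightarrow>\<^sub>0 real"
  assume "F - F' \<in> span tensor_relations" "G - G' \<in> span tensor_relations"
  then have "(F - F') - (G - G') \<in> span tensor_relations" by (rule span_diff)
  then show "F - G - (F' - G') \<in> span tensor_relations" by (simp add: algebra_simps)
qed

lift_definition scaleR_tensor :: "real \<Rightarrow> ('a, 'b) tensor \<Rightarrow> ('a, 'b) tensor"
  is scaleR
  by (metis (no_types, lifting) scaleR_diff_right span_scale)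

instance
  by standard (transfer; simp add: span_zero algebra_simps)+

end

lift_definition pure_tensor :: "'a::real_vector \<Rightarrow> 'b::real_vector \<Rightarrow> ('a, 'b) tensor"
  is free_gen .

definition free_lift :: "('a \<Rightarrow> 'b \<Rightarrow> 'c::real_vector) \<Rightarrow> ('a \<times> 'b \<Rightarrow>\<^sub>0 real) \<Rightarrow> 'c"
  where "free_lift h F =
    (\<Sum>p\<in>Poly_Mapping.keys F. Poly_Mapping.lookup F p *\<^sub>R h (fst p) (snd p))"

text \<open>Only meaningful for bilinear \<open>h\<close>, when it is independent of the representative
  \<open>rep_tensor t\<close>; see \<open>tensor_lift_pure\<close> and \<open>tensor_lift_unique\<close>.\<close>

definition tensor_lift ::
    "('a::real_vector \<Rightarrow> 'b::real_vector \<Rightarrow> 'c::real_vector) \<Rightarrow> ('a, 'b) tensor \<Rightarrow> 'c"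
  where "tensor_lift h t = free_lift h (rep_tensor t)"

definition tensor_map ::
    "('a::real_vector \<Rightarrow> 'c::real_vector) \<Rightarrow> ('b::real_vector \<Rightarrow> 'd::real_vector) \<Rightarrow>
     ('a, 'b) tensor \<Rightarrow> ('c, 'd) tensor"
  where "tensor_map f g = tensor_lift (\<lambda>x y. pure_tensor (f x) (g y))"

text \<open>Over a field, the tensor product of two subspaces embeds into the tensor product of
  the ambient spaces, with the following image; see \<open>independent_pure_tensors\<close>.\<close>

definition tensor_space ::
    "'a::real_vector set \<Rightarrow> 'b::real_vector set \<Rightarrow> ('a, 'b) tensor set"
  where "tensor_space A B = span {pure_tensor x y | x y. x \<in> A \<and> y \<in> B}"

lemma bilinear_pure_tensor: "bilinear pure_tensor"
proof -
  have "pure_tensor (x + x') y = pure_tensor x y + pure_tensor x' y"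
    for x x' :: 'a and y :: 'b
    by (transfer, rule span_base, unfold tensor_relations_def diff_diff_eq[symmetric]) blast
  moreover have "pure_tensor x (y + y') = pure_tensor x y + pure_tensor x y'"
    for x :: 'a and y y' :: 'b
    by (transfer, rule span_base, unfold tensor_relations_def diff_diff_eq[symmetric]) blast
  moreover have "pure_tensor (c *\<^sub>R x) y = c *\<^sub>R pure_tensor x y" for c and x :: 'a and y :: 'b
    by (transfer, rule span_base, unfold tensor_relations_def) blast
  moreover have "pure_tensor x (c *\<^sub>R y) = c *\<^sub>R pure_tensor x y" for c and x :: 'a and y :: 'b
    by (transfer, rule span_base, unfold tensor_relations_def) blast
  ultimately show ?thesis
    by (auto simp: bilinear_def intro!: linearI)
qed

lemma lookup_scaleR [simp]:
  "Poly_Mapping.lookup (c *\<^sub>R F) p = c *\<^sub>R Poly_Mapping.lookup (F :: 'a \<Rightarrow>\<^sub>0 'b::real_vector) p"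
proof -
  have "finite {i. c *\<^sub>R Poly_Mapping.lookup F i \<noteq> 0}"
    by (rule finite_subset[OF _ finite_lookup[of F]]) auto
  then show ?thesis
    by (simp add: scaleR_poly_mapping_def)
qed

lemma free_lift_superset:
  assumes "finite S" "Poly_Mapping.keys F \<subseteq> S"
  shows "free_lift h F = (\<Sum>p\<in>S. Poly_Mapping.lookup F p *\<^sub>R h (fst p) (snd p))"
  unfolding free_lift_def
  by (rule sum.mono_neutral_left) (use assms in \<open>auto simp: in_keys_iff\<close>)

lemma linear_free_lift: "linear (free_lift h)"
proof (rule linearI)
  fix F G :: "'a \<times> 'b \<Rightarrow>\<^sub>0 real"
  let ?S = "Poly_Mapping.keys F \<union> Poly_Mapping.keys G"
  show "free_lift h (F + G) = free_lift h F + free_lift h G"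
    using keys_add[of F G]
    by (simp add: free_lift_superset[of ?S] lookup_add scaleR_left_distrib sum.distrib)
next
  fix c and F :: "'a \<times> 'b \<Rightarrow>\<^sub>0 real"
  have "Poly_Mapping.keys (c *\<^sub>R F) \<subseteq> Poly_Mapping.keys F"
    by (auto simp: in_keys_iff)
  then show "free_lift h (c *\<^sub>R F) = c *\<^sub>R free_lift h F"
    by (simp add: free_lift_superset[of "Poly_Mapping.keys F"] scaleR_sum_right)
qed

lemma free_lift_gen [simp]: "free_lift h (free_gen x y) = h x y"
  by (simp add: free_lift_def)

lemma free_lift_relations:
  assumes h: "bilinear h" and F: "F \<in> span tensor_relations"
  shows "free_lift h F = 0"
proof -
  interpret L: linear "free_lift h" by (rule linear_free_lift)
  have "free_lift h G = 0" if "G \<in> tensor_relations" for G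
    using that unfolding tensor_relations_def
    by (auto simp: L.diff L.scale bilinear_ladd[OF h] bilinear_radd[OF h]
        bilinear_lmul[OF h] bilinear_rmul[OF h])
  then show ?thesis
    using F linear_eq_0_on_span[OF linear_free_lift] by blast
qed

lemma tensor_lift_abs:
  assumes h: "bilinear h"
  shows "tensor_lift h (abs_tensor F) = free_lift h F"
proof -
  have "rep_tensor (abs_tensor F) - F \<in> span tensor_relations"
    using Quotient3_rep_abs[OF Quotient3_tensor] by (simp add: span_zero)
  from free_lift_relations[OF h this] show ?thesis
    by (simp add: tensor_lift_def linear_diff[OF linear_free_lift])
qed

lemma tensor_lift_pure: "bilinear h \<Longrightarrow> tensor_lift h (pure_tensor x y) = h x y"
  by (simp add: pure_tensor.abs_eq tensor_lift_abs)

lemma linear_tensor_lift: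
  assumes h: "bilinear h"
  shows "linear (tensor_lift h)"
proof (rule linearI)
  fix s t
  show "tensor_lift h (s + t) = tensor_lift h s + tensor_lift h t"
    by (induct s; induct t)
      (simp add: plus_tensor.abs_eq tensor_lift_abs[OF h] linear_add[OF linear_free_lift])
next
  fix c t
  show "tensor_lift h (c *\<^sub>R t) = c *\<^sub>R tensor_lift h t"
    by (induct t)
      (simp add: scaleR_tensor.abs_eq tensor_lift_abs[OF h] linear_scale[OF linear_free_lift])
qed

lemma span_pure_tensors: "span {pure_tensor x y | x y. True} = UNIV"
proof -
  have "t \<in> span {pure_tensor x y | x y. True}" for t :: "('a, 'b) tensor"
  proof (induct t)
    fix F :: "('a \<times> 'b) \<Rightarrow>\<^sub>0 real"
    have lin: "linear abs_tensor"
      by (rule linearI) (simp_all add: plus_tensor.abs_eq scaleR_tensor.abs_eq)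
    have "F = (\<Sum>p\<in>Poly_Mapping.keys F. Poly_Mapping.lookup F p *\<^sub>R free_gen (fst p) (snd p))"
    proof (rule poly_mapping_eqI)
      fix q
      show "Poly_Mapping.lookup F q = Poly_Mapping.lookup
          (\<Sum>p\<in>Poly_Mapping.keys F. Poly_Mapping.lookup F p *\<^sub>R free_gen (fst p) (snd p)) q"
        by (simp add: lookup_sum lookup_single when_def if_distrib[of "\<lambda>u. _ * u"]
            in_keys_iff cong: if_cong)
    qed
    then have "abs_tensor F = (\<Sum>p\<in>Poly_Mapping.keys F.
        Poly_Mapping.lookup F p *\<^sub>R pure_tensor (fst p) (snd p))"
      by (metis (no_types, lifting) linear_scale[OF lin] linear_sum[OF lin] pure_tensor.abs_eq
          sum.cong)
    moreover have "pure_tensor x y \<in> span {pure_tensor x y | x y. True}" for x :: 'a and y :: 'b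
      by (rule span_base) blast
    ultimately show "abs_tensor F \<in> span {pure_tensor x y | x y. True}"
      by (simp add: span_sum span_scale)
  qed
  then show ?thesis by blast
qed

lemma tensor_lift_unique:
  assumes "bilinear h" "linear f" "\<And>x y. f (pure_tensor x y) = h x y"
  shows "f = tensor_lift h"
proof
  fix t
  show "f t = tensor_lift h t"
  proof (rule linear_eq_on[OF assms(2) linear_tensor_lift[OF assms(1)]])
    show "t \<in> span {pure_tensor x y | x y. True}"
      unfolding span_pure_tensors by (rule UNIV_I)
  qed (auto simp: assms tensor_lift_pure)
qed

lemma bilinear_tensor_map:
  assumes "linear f" "linear g"
  shows "bilinear (\<lambda>x y. pure_tensor (f x) (g y))"
  using bilinear_pure_tensor assms
  by (auto simp: bilinear_def linear_iff)

lemma linear_tensor_map: "linear f \<Longrightarrow> linear g \<Longrightarrow> linear (tensor_map f g)"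
  unfolding tensor_map_def by (intro linear_tensor_lift bilinear_tensor_map)

lemma tensor_map_pure:
  "linear f \<Longrightarrow> linear g \<Longrightarrow> tensor_map f g (pure_tensor x y) = pure_tensor (f x) (g y)"
  unfolding tensor_map_def by (simp add: tensor_lift_pure bilinear_tensor_map)

lemma independent_pure_tensors:
  assumes A: "independent A" and B: "independent B"
  shows "inj_on (\<lambda>(x, y). pure_tensor x y) (A \<times> B)"
    and "independent ((\<lambda>(x, y). pure_tensor x y) ` (A \<times> B))"
proof -
  define coord where "coord a b = tensor_lift (\<lambda>x y.
    construct A (\<lambda>z. if z = a then 1 else 0) x * construct B (\<lambda>z. if z = b then 1 else (0::real)) y)"
    for a b
  have bil: "bilinear (\<lambda>x y.
    construct A (\<lambda>z. if z = a then 1 else 0) x * construct B (\<lambda>z. if z = b then 1 else (0::real)) y)"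
    for a b
    using linear_construct[OF A, of "\<lambda>z. if z = a then 1 else (0::real)"]
      linear_construct[OF B, of "\<lambda>z. if z = b then 1 else (0::real)"]
    by (auto simp: bilinear_def linear_iff algebra_simps)
  have lin: "linear (coord a b)" for a b
    unfolding coord_def by (rule linear_tensor_lift[OF bil])
  have val: "coord a b (pure_tensor x y) = (if x = a \<and> y = b then 1 else 0)"
    if "x \<in> A" "y \<in> B" for a b x y
    using that by (simp add: coord_def tensor_lift_pure[OF bil] construct_basis A B)
  show inj: "inj_on (\<lambda>(x, y). pure_tensor x y) (A \<times> B)"
  proof (rule inj_onI, clarify)
    fix x y x' y'
    assume *: "x \<in> A" "y \<in> B" "x' \<in> A" "y' \<in> B" "pure_tensor x y = pure_tensor x' y'"
    have "coord x y (pure_tensor x' y') = 1"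
      using val[OF *(1,2), of x y] unfolding *(5) by simp
    then show "x = x' \<and> y = y'"
      using val[OF *(3,4), of x y] by (metis zero_neq_one)
  qed
  show "independent ((\<lambda>(x, y). pure_tensor x y) ` (A \<times> B))"
  proof
    assume "dependent ((\<lambda>(x, y). pure_tensor x y) ` (A \<times> B))"
    then obtain a b where ab: "a \<in> A" "b \<in> B" and
      sp: "pure_tensor a b \<in>
        span ((\<lambda>(x, y). pure_tensor x y) ` (A \<times> B) - {pure_tensor a b})"
      unfolding dependent_def by auto
    have "coord a b t = 0"
      if "t \<in> (\<lambda>(x, y). pure_tensor x y) ` (A \<times> B) - {pure_tensor a b}" for t
    proof -
      from that obtain x y where t: "t = pure_tensor x y" "x \<in> A" "y \<in> B"
        and "t \<noteq> pure_tensor a b"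
        by auto
      then have "\<not> (x = a \<and> y = b)" by blast
      then show ?thesis unfolding t(1) val[OF t(2,3)] by simp
    qed
    then have "coord a b (pure_tensor a b) = 0"
      using linear_eq_0_on_span[OF lin _ sp] by blast
    then show False using val[OF ab, of a b] by simp
  qed
qed


section \<open>Simplicial vector spaces\<close>

text \<open>The spaces in the various degrees are subspaces of one ambient real vector space, which is
  no restriction (take a direct sum). Faces and degeneracies are total functions on the ambient
  space; since a linear map on a subspace extends linearly, it is no restriction either to ask
  for linearity everywhere. They are only evaluated on the spaces \<open>obj V l\<close>, and only
  for valid indices: \<open>face V l i\<close> is the face \<open>d\<^sub>i\<close> from degree \<open>l\<close> to \<open>l - 1\<close>
  and \<open>degen V l j\<close> is the degeneracy \<open>s\<^sub>j\<close> from degree \<open>l\<close> to \<open>l + 1\<close>.\<close>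

record 'a simplicial_data =
  obj :: "nat \<Rightarrow> 'a set"
  face :: "nat \<Rightarrow> nat \<Rightarrow> 'a \<Rightarrow> 'a"
  degen :: "nat \<Rightarrow> nat \<Rightarrow> 'a \<Rightarrow> 'a"

locale simplicial_vector_space =
  fixes V :: "'a::real_vector simplicial_data"
  assumes subspace_obj: "subspace (obj V l)"
    and finite_dim_obj: "\<exists>B. finite B \<and> obj V l = span B"
    and linear_face: "\<lbrakk>1 \<le> l; i \<le> l\<rbrakk> \<Longrightarrow> linear (face V l i)"
    and face_in: "\<lbrakk>1 \<le> l; i \<le> l; x \<in> obj V l\<rbrakk> \<Longrightarrow> face V l i x \<in> obj V (l - 1)"
    and linear_degen: "j \<le> l \<Longrightarrow> linear (degen V l j)"
    and degen_in: "\<lbrakk>j \<le> l; x \<in> obj V l\<rbrakk> \<Longrightarrow> degen V l j x \<in> obj V (l + 1)"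
    and face_face: "\<lbrakk>2 \<le> l; i < j; j \<le> l; x \<in> obj V l\<rbrakk> \<Longrightarrow>
      face V (l - 1) i (face V l j x) = face V (l - 1) (j - 1) (face V l i x)"
    and degen_degen: "\<lbrakk>i \<le> j; j \<le> l; x \<in> obj V l\<rbrakk> \<Longrightarrow>
      degen V (l + 1) i (degen V l j x) = degen V (l + 1) (j + 1) (degen V l i x)"
    and face_degen_less: "\<lbrakk>i < j; j \<le> l; x \<in> obj V l\<rbrakk> \<Longrightarrow>
      face V (l + 1) i (degen V l j x) = degen V (l - 1) (j - 1) (face V l i x)"
    and face_degen_eq: "\<lbrakk>j \<le> l; x \<in> obj V l\<rbrakk> \<Longrightarrow> face V (l + 1) j (degen V l j x) = x"
    and face_degen_Suc: "\<lbrakk>j \<le> l; x \<in> obj V l\<rbrakk> \<Longrightarrow> face V (l + 1) (j + 1) (degen V l j x) = x"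
    and face_degen_greater: "\<lbrakk>j + 1 < i; i \<le> l + 1; x \<in> obj V l\<rbrakk> \<Longrightarrow>
      face V (l + 1) i (degen V l j x) = degen V (l - 1) j (face V l (i - 1) x)"

text \<open>Tuples \<open>(x\<^sub>i)\<close> indexed by \<open>i \<in> {0..l} - {k}\<close> are extensional functions on that
  index set.\<close>

definition horn :: "'a simplicial_data \<Rightarrow> nat \<Rightarrow> nat \<Rightarrow> (nat \<Rightarrow> 'a) set"
  where "horn V l k = {x \<in> ({0..l} - {k}) \<rightarrow>\<^sub>E obj V (l - 1).
    \<forall>i\<in>{0..l} - {k}. \<forall>j\<in>{0..l} - {k}. i < j \<longrightarrow>
      face V (l - 1) i (x j) = face V (l - 1) (j - 1) (x i)}"

definition horn_map :: "'a simplicial_data \<Rightarrow> nat \<Rightarrow> nat \<Rightarrow> 'a \<Rightarrow> nat \<Rightarrow> 'a"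
  where "horn_map V l k x = (\<lambda>i\<in>{0..l} - {k}. face V l i x)"

locale VS_groupoid = simplicial_vector_space V
  for n :: nat and V :: "'a::real_vector simplicial_data" +
  assumes horn_map_surj: "\<lbrakk>1 \<le> l; k \<le> l\<rbrakk> \<Longrightarrow> horn_map V l k ` obj V l = horn V l k"
    and horn_map_bij: "\<lbrakk>n + 1 \<le> l; k \<le> l\<rbrakk> \<Longrightarrow> bij_betw (horn_map V l k) (obj V l) (horn V l k)"

definition tensor_product ::
    "'a::real_vector simplicial_data \<Rightarrow> 'b::real_vector simplicial_data \<Rightarrow>
     ('a, 'b) tensor simplicial_data"
  where "tensor_product V W =
    \<lparr>obj = (\<lambda>l. tensor_space (obj V l) (obj W l)),
     face = (\<lambda>l i. tensor_map (face V l i) (face W l i)),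
     degen = (\<lambda>l j. tensor_map (degen V l j) (degen W l j))\<rparr>"


section \<open>Normalized complex, order and homotopy type\<close>

definition normalized :: "'a::real_vector simplicial_data \<Rightarrow> nat \<Rightarrow> 'a set"
  where "normalized V l = {x \<in> obj V l. \<forall>i<l. face V l i x = 0}"

definition normalized_diff :: "'a::real_vector simplicial_data \<Rightarrow> nat \<Rightarrow> 'a \<Rightarrow> 'a"
  where "normalized_diff V l x = (-1) ^ l *\<^sub>R face V l l x"

definition cycles :: "'a::real_vector simplicial_data \<Rightarrow> nat \<Rightarrow> 'a set"
  where "cycles V l = {x \<in> normalized V l. 1 \<le> l \<longrightarrow> normalized_diff V l x = 0}"

definition boundaries :: "'a::real_vector simplicial_data \<Rightarrow> nat \<Rightarrow> 'a set"
  where "boundaries V l = normalized_diff V (l + 1) ` normalized V (l + 1)"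

text \<open>The quotient of cycles by boundaries, as a set of cosets; its zero is \<open>boundaries V l\<close>.\<close>

definition homology :: "'a::real_vector simplicial_data \<Rightarrow> nat \<Rightarrow> 'a set set"
  where "homology V l = (\<lambda>z. (+) z ` boundaries V l) ` cycles V l"

definition has_order :: "'a::real_vector simplicial_data \<Rightarrow> nat \<Rightarrow> bool"
  where "has_order V n \<longleftrightarrow> normalized V n \<noteq> {0} \<and> (\<forall>l. normalized V l \<noteq> {0} \<longrightarrow> l \<le> n)"

definition order_at_least :: "'a::real_vector simplicial_data \<Rightarrow> nat \<Rightarrow> bool"
  where "order_at_least V r \<longleftrightarrow> (\<exists>l\<ge>r. normalized V l \<noteq> {0})"

definition homotopy_type_at_most :: "'a::real_vector simplicial_data \<Rightarrow> nat \<Rightarrow> bool"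
  where "homotopy_type_at_most V r \<longleftrightarrow> (\<forall>l>r. homology V l = {boundaries V l})"


lemma tensor_map_in:
  assumes fg: "linear f" "linear g" and "f ` A \<subseteq> A'" "g ` B \<subseteq> B'" "t \<in> tensor_space A B"
  shows "tensor_map f g t \<in> tensor_space A' B'"
proof -
  have "tensor_map f g ` {pure_tensor x y | x y. x \<in> A \<and> y \<in> B}
      \<subseteq> {pure_tensor x y | x y. x \<in> A' \<and> y \<in> B'}"
    using assms(3,4) by (clarsimp simp: tensor_map_pure[OF fg]) blast
  then show ?thesis
    using assms(5) linear_span_image[OF linear_tensor_map[OF fg]] span_mono
    unfolding tensor_space_def by blast
qed

lemma finite_dim_tensor_space:
  assumes "finite A" "finite B"
  shows "\<exists>C. finite C \<and> tensor_space (span A) (span B) = span C"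
proof (intro exI conjI)
  let ?C = "(\<lambda>(x, y). pure_tensor x y) ` (A \<times> B)"
  show "finite ?C" using assms by simp
  have 1: "pure_tensor x y \<in> span ?C" if "x \<in> A" "y \<in> span B" for x y
    using that(2)
  proof (induct rule: span_induct)
    case base
    show ?case
      by (simp add: subspace_def bilinear_radd[OF bilinear_pure_tensor] span_zero span_add
          bilinear_rmul[OF bilinear_pure_tensor] bilinear_rzero[OF bilinear_pure_tensor] span_scale)
  next
    case (step y)
    then show ?case using that(1) by (auto intro!: span_base)
  qed
  have 2: "pure_tensor x y \<in> span ?C" if "x \<in> span A" "y \<in> span B" for x y
    using that(1)
  proof (induct rule: span_induct)
    case base
    show ?case
      by (simp add: subspace_def bilinear_ladd[OF bilinear_pure_tensor] span_zero span_add
          bilinear_lmul[OF bilinear_pure_tensor] bilinear_lzero[OF bilinear_pure_tensor] span_scale)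
  next
    case (step x)
    then show ?case using 1 that(2) by simp
  qed
  show "tensor_space (span A) (span B) = span ?C"
    unfolding tensor_space_def
  proof (rule span_eq[THEN iffD2], intro conjI subsetI)
    fix t assume "t \<in> {pure_tensor x y | x y. x \<in> span A \<and> y \<in> span B}"
    then show "t \<in> span ?C" using 2 by auto
  next
    fix t assume "t \<in> ?C"
    then show "t \<in> span {pure_tensor x y | x y. x \<in> span A \<and> y \<in> span B}"
      by (auto intro!: span_base intro: span_base[of _ A] span_base[of _ B])
  qed
qed

lemma tensor_map_comp_eq:
  assumes lin: "linear f" "linear f'" "linear g" "linear g'"
      "linear h" "linear h'" "linear k" "linear k'"
    and "\<And>x. x \<in> A \<Longrightarrow> f (g x) = h (k x)" "\<And>y. y \<in> B \<Longrightarrow> f' (g' y) = h' (k' y)"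
    and t: "t \<in> tensor_space A B"
  shows "tensor_map f f' (tensor_map g g' t) = tensor_map h h' (tensor_map k k' t)"
proof -
  have "(tensor_map f f' \<circ> tensor_map g g') t = (tensor_map h h' \<circ> tensor_map k k') t"
  proof (rule linear_eq_on[OF _ _ t[unfolded tensor_space_def]])
    show "linear (tensor_map f f' \<circ> tensor_map g g')"
      by (intro linear_compose linear_tensor_map lin)
    show "linear (tensor_map h h' \<circ> tensor_map k k')"
      by (intro linear_compose linear_tensor_map lin)
  qed (use assms in \<open>auto simp: tensor_map_pure\<close>)
  then show ?thesis by simp
qed

lemma tensor_map_comp_id:
  assumes lin: "linear f" "linear f'" "linear g" "linear g'"
    and "\<And>x. x \<in> A \<Longrightarrow> f (g x) = x" "\<And>y. y \<in> B \<Longrightarrow> f' (g' y) = y"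
    and t: "t \<in> tensor_space A B"
  shows "tensor_map f f' (tensor_map g g' t) = t"
proof -
  have "(tensor_map f f' \<circ> tensor_map g g') t = id t"
  proof (rule linear_eq_on[OF _ _ t[unfolded tensor_space_def]])
    show "linear (tensor_map f f' \<circ> tensor_map g g')"
      by (intro linear_compose linear_tensor_map lin)
  qed (use assms in \<open>auto simp: tensor_map_pure linear_id[unfolded id_def] id_def\<close>)
  then show ?thesis by simp
qed

lemma simplicial_vector_space_tensor_product:
  assumes "simplicial_vector_space V" "simplicial_vector_space W"
  shows "simplicial_vector_space (tensor_product V W)"
proof -
  interpret V: simplicial_vector_space V by fact
  interpret W: simplicial_vector_space W by fact
  note simps = tensor_product_def simplicial_data.simps
  show ?thesis
  proof (rule simplicial_vector_space.intro, unfold simps, goal_cases)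
    case (1 l)
    show ?case by (simp add: tensor_space_def)
  next
    case (2 l)
    show ?case using V.finite_dim_obj[of l] W.finite_dim_obj[of l] finite_dim_tensor_space by metis
  next
    case 3
    then show ?case by (intro linear_tensor_map V.linear_face W.linear_face)
  next
    case (4 l i x)
    then show ?case
      by (intro tensor_map_in[OF V.linear_face W.linear_face _ _ 4(3)])
        (auto simp: V.face_in[simplified] W.face_in[simplified])
  next
    case 5
    then show ?case by (intro linear_tensor_map V.linear_degen W.linear_degen)
  next
    case (6 j l x)
    then show ?case
      by (intro tensor_map_in[OF V.linear_degen W.linear_degen _ _ 6(2)])
        (auto simp: V.degen_in[simplified] W.degen_in[simplified])
  next
    case (7 l i j x)
    then show ?case
      by (intro tensor_map_comp_eq[OF _ _ _ _ _ _ _ _ _ _ 7(4)] V.linear_face W.linear_face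
          V.face_face W.face_face) auto
  next
    case (8 i j l x)
    then show ?case
      by (intro tensor_map_comp_eq[OF _ _ _ _ _ _ _ _ _ _ 8(3)] V.linear_degen W.linear_degen
          V.degen_degen W.degen_degen) auto
  next
    case (9 i j l x)
    then show ?case
      by (intro tensor_map_comp_eq[OF _ _ _ _ _ _ _ _ _ _ 9(3)] V.linear_degen W.linear_degen
          V.linear_face W.linear_face V.face_degen_less W.face_degen_less) auto
  next
    case (10 j l x)
    then show ?case
      by (intro tensor_map_comp_id[OF _ _ _ _ _ _ 10(2)] V.linear_degen W.linear_degen
          V.linear_face W.linear_face V.face_degen_eq W.face_degen_eq) auto
  next
    case (11 j l x)
    then show ?case
      by (intro tensor_map_comp_id[OF _ _ _ _ _ _ 11(2)] V.linear_degen W.linear_degen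
          V.linear_face W.linear_face V.face_degen_Suc W.face_degen_Suc) auto
  next
    case (12 j i l x)
    then show ?case
      by (intro tensor_map_comp_eq[OF _ _ _ _ _ _ _ _ _ _ 12(3)] V.linear_degen W.linear_degen
          V.linear_face W.linear_face V.face_degen_greater W.face_degen_greater) auto
  qed
qed

end

theory Submission
  imports Defs
begin

text \<open>Both halves concern simplicial vector spaces \<open>V\<close> and \<open>W\<close> whose normalized complexes live in degrees
  \<open>\<le> n\<close> and \<open>\<le> m\<close> and are nonzero in degrees \<open>n\<close> and \<open>m\<close>. By the Eilenberg-Zilber theorem,
  \<open>N(V \<otimes> W)\<close> has the homology of \<open>N(V) \<otimes> N(W)\<close>, which vanishes above \<open>n + m\<close>, and it
  contains \<open>N(V) \<otimes> N(W)\<close> as a summand. The two consequences have direct proofs.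

  For the homotopy type, let \<open>PV\<close> be the decalage of \<open>V\<close>, that is \<open>PV\<^sub>l = V\<^sub>l\<^sub>+\<^sub>1\<close> without the last
  face and degeneracy. The omitted face is a map \<open>PV \<rightarrow> V\<close>, split in every degree by a
  degeneracy; its kernel \<open>KV\<close> is a model of the loop space, and \<open>N(KV)\<close> vanishes from one degree
  lower than \<open>N(V)\<close> on. Because of the splitting, \<open>KV \<otimes> W \<rightarrow> PV \<otimes> W \<rightarrow> V \<otimes> W\<close> is again short exact,
  and its long exact sequence reduces a vanishing statement for \<open>V \<otimes> W\<close> to the same one for
  \<open>PV \<otimes> W\<close> and, one degree lower, for \<open>KV \<otimes> W\<close> (\<open>acyclic_in_tensor_path\<close>). Induction on the order
  of \<open>V\<close> thus leaves only \<open>PV \<otimes> W\<close> (\<open>acyclic_in_tensor_product_if_path\<close>). The same induction on the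
  order of \<open>W\<close> reduces \<open>PV \<otimes> W\<close> to \<open>PV \<otimes> PW\<close>, and this is \<open>P(V \<otimes> W)\<close>, for which the omitted
  degeneracy is a contraction (\<open>acyclic_in_path_object\<close>).

  For the order, suppose \<open>N(V \<otimes> W)\<close> vanishes in degree \<open>n + m\<close>. Then \<open>(V \<otimes> W)\<^sub>n\<^sub>+\<^sub>m\<close> is spanned by
  degenerate simplices (\<open>decompose_normalized_degenerate\<close>). But take functionals on \<open>V\<^sub>n\<close> and \<open>W\<^sub>m\<close>
  that kill degenerate simplices without being zero. Composed with the Alexander-Whitney map
  (front \<open>n\<close>-face in \<open>V\<close>, back \<open>m\<close>-face in \<open>W\<close>), they give a nonzero functional on \<open>(V \<otimes> W)\<^sub>n\<^sub>+\<^sub>m\<close> that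
  kills every \<open>s\<^sub>j (a \<otimes> b)\<close>: the front face of \<open>s\<^sub>j a\<close> is degenerate if \<open>j < n\<close>, the back face of
  \<open>s\<^sub>j b\<close> is degenerate if \<open>j \<ge> n\<close>.\<close>

section \<open>Normalization\<close>

lemma normalized_iff: "x \<in> normalized X l \<longleftrightarrow> x \<in> obj X l \<and> (\<forall>i<l. face X l i x = 0)"
  by (simp add: normalized_def)

context simplicial_vector_space
begin

lemma zero_in_obj [simp]: "0 \<in> obj V l"
  using subspace_obj subspace_0 by blast

lemma face_zero [simp]: "\<lbrakk>1 \<le> l; i \<le> l\<rbrakk> \<Longrightarrow> face V l i 0 = 0"
  using linear_0[OF linear_face] by simp

lemma degen_zero [simp]: "j \<le> l \<Longrightarrow> degen V l j 0 = 0"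
  using linear_0[OF linear_degen] by simp

lemma face_diff: "\<lbrakk>1 \<le> l; i \<le> l\<rbrakk> \<Longrightarrow> face V l i (x - y) = face V l i x - face V l i y"
  using linear_diff[OF linear_face] by simp

lemma subspace_normalized: "subspace (normalized V l)"
proof -
  have "normalized V l = obj V l \<inter> (\<Inter>i\<in>{..<l}. {x. face V l i x = 0})"
    by (auto simp: normalized_def)
  moreover have "subspace {x. face V l i x = 0}" if "i < l" for i
    by (rule linear_subspace_kernel, rule linear_face) (use that in auto)
  ultimately show ?thesis
    by (auto intro!: subspace_inter subspace_obj subspace_Inter)
qed

definition kill_face :: "nat \<Rightarrow> nat \<Rightarrow> 'a \<Rightarrow> 'a"
  where "kill_face l k x = x - degen V (l - 1) k (face V l k x)"

context
  fixes l k :: nat assumes k: "k < l"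
begin

lemma linear_kill_face: "linear (kill_face l k)"
proof -
  have "linear (\<lambda>x. degen V (l - 1) k (face V l k x))"
    using linear_compose[OF linear_face[of l k] linear_degen[of k "l - 1"]] k
    by (simp add: o_def)
  then show ?thesis
    unfolding kill_face_def by (intro linear_compose_sub linear_id[unfolded id_def])
qed

lemma degen_face_in: "x \<in> obj V l \<Longrightarrow> degen V (l - 1) k (face V l k x) \<in> obj V l"
  using degen_in[of k "l - 1"] face_in[of l k] k by simp

lemma kill_face_in: "x \<in> obj V l \<Longrightarrow> kill_face l k x \<in> obj V l"
  unfolding kill_face_def by (intro subspace_diff subspace_obj degen_face_in)

text \<open>The operator \<open>1 - s\<^sub>k d\<^sub>k\<close> kills \<open>d\<^sub>k\<close> because \<open>d\<^sub>k s\<^sub>k = 1\<close>, and it preserves the vanishing of the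
  lower faces because \<open>d\<^sub>i s\<^sub>k d\<^sub>k = s\<^sub>k\<^sub>-\<^sub>1 d\<^sub>k\<^sub>-\<^sub>1 d\<^sub>i\<close> for \<open>i < k\<close>. So faces can be killed one after the
  other in increasing order.\<close>

lemma face_kill_face:
  assumes x: "x \<in> obj V l" and "\<And>i. i < k \<Longrightarrow> face V l i x = 0" and "i \<le> k"
  shows "face V l i (kill_face l k x) = 0"
proof (cases "i = k")
  case True
  then show ?thesis
    using face_degen_eq[of k "l - 1" "face V l k x"] face_in[of l k x] x k
    by (simp add: kill_face_def face_diff)
next
  case False
  then have i: "i < k" using assms by simp
  have "face V l i (degen V (l - 1) k (face V l k x))
      = degen V (l - 2) (k - 1) (face V (l - 1) i (face V l k x))"
    using face_degen_less[of i k "l - 1" "face V l k x"] face_in[of l k x] x k i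
    by (simp add: numeral_2_eq_2)
  also have "face V (l - 1) i (face V l k x) = face V (l - 1) (k - 1) (face V l i x)"
    using face_face[of l i k x] x k i by simp
  finally show ?thesis
    using i k assms(2) by (simp add: kill_face_def face_diff)
qed

end

text \<open>Applying \<open>1 - s\<^sub>k d\<^sub>k\<close> for \<open>k = 0, \<dots>, l - 1\<close> in turn makes a simplex normalized and changes it only by
  degenerate simplices.\<close>

lemma decompose_normalized_degenerate:
  assumes x: "x \<in> obj V l"
  shows "\<exists>y\<in>normalized V l. x - y \<in> span (\<Union>j<l. degen V (l - 1) j ` obj V (l - 1))"
proof -
  let ?D = "span (\<Union>j<l. degen V (l - 1) j ` obj V (l - 1))"
  have "\<exists>y\<in>obj V l. (\<forall>i<k. face V l i y = 0) \<and> x - y \<in> ?D" if "k \<le> l" for k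
    using that
  proof (induction k)
    case 0
    then show ?case using x by (auto intro!: bexI[of _ x] span_zero)
  next
    case (Suc k)
    then obtain y where y: "y \<in> obj V l" "\<forall>i<k. face V l i y = 0" "x - y \<in> ?D" by auto
    have k: "k < l" using Suc by simp
    have "degen V (l - 1) k (face V l k y) \<in> ?D"
      using k face_in[of l k y] y(1) by (intro span_base) auto
    from span_add[OF y(3) this] have "x - kill_face l k y \<in> ?D"
      by (simp add: kill_face_def algebra_simps)
    then show ?case
      using y k by (intro bexI[of _ "kill_face l k y"]) (auto intro!: face_kill_face kill_face_in)
  qed
  from this[of l] show ?thesis by (auto simp: normalized_iff)
qed

end

section \<open>Vanishing homology\<close>

text \<open>Vanishing of the homology of the normalized complex in one degree, expressed with the last
  face: the sign of the differential changes neither its kernel nor its image.\<close>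

definition acyclic_in :: "'a::real_vector simplicial_data \<Rightarrow> nat \<Rightarrow> bool"
  where "acyclic_in X l \<longleftrightarrow> (\<forall>z\<in>normalized X l. (1 \<le> l \<longrightarrow> face X l l z = 0) \<longrightarrow>
    (\<exists>w\<in>normalized X (l + 1). face X (l + 1) (l + 1) w = z))"

lemma (in simplicial_vector_space) homology_eq_zero:
  assumes "acyclic_in V l"
  shows "homology V l = {boundaries V l}"
proof -
  have lin: "linear (normalized_diff V (l + 1))"
    unfolding normalized_diff_def
    by (intro linear_compose_scale_right linear_face) auto
  have sub: "subspace (boundaries V l)"
    unfolding boundaries_def by (intro linear_subspace_image lin subspace_normalized)
  have "z \<in> boundaries V l" if z: "z \<in> cycles V l" for z
  proof -
    have "z \<in> normalized V l" "1 \<le> l \<longrightarrow> face V l l z = 0"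
      using z by (auto simp: cycles_def normalized_diff_def)
    then obtain w where w: "w \<in> normalized V (l + 1)" "face V (l + 1) (l + 1) w = z"
      using assms unfolding acyclic_in_def by blast
    then have "normalized_diff V (l + 1) w \<in> boundaries V l"
      unfolding boundaries_def by blast
    then have "(-1) ^ (l + 1) *\<^sub>R normalized_diff V (l + 1) w \<in> boundaries V l"
      by (intro subspace_scale sub)
    then show ?thesis
      by (simp add: normalized_diff_def w[simplified] flip: power_mult_distrib)
  qed
  moreover have "(+) z ` boundaries V l = boundaries V l" if z: "z \<in> boundaries V l" for z
  proof (intro equalityI subsetI)
    fix b assume "b \<in> boundaries V l"
    then have "b - z \<in> boundaries V l" using z sub subspace_diff by blast
    then show "b \<in> (+) z ` boundaries V l" by (intro image_eqI[of _ _ "b - z"]) auto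
  qed (use z sub subspace_add in auto)
  moreover have "0 \<in> cycles V l"
    by (simp add: cycles_def normalized_iff normalized_diff_def)
  ultimately show ?thesis unfolding homology_def by blast
qed

text \<open>Normalization is exact: any preimage of a normalized simplex can be normalized by the operators
  \<open>1 - s\<^sub>k d\<^sub>k\<close>, and these do not move the image, which has zero faces already.\<close>

lemma lift_normalized:
  assumes Y: "simplicial_vector_space Y" and Z: "simplicial_vector_space Z"
    and f: "\<And>l. linear (f l)"
    and face: "\<And>l i y. \<lbrakk>1 \<le> l; i \<le> l; y \<in> obj Y l\<rbrakk> \<Longrightarrow> f (l - 1) (face Y l i y) = face Z l i (f l y)"
    and degen: "\<And>l j y. \<lbrakk>j \<le> l; y \<in> obj Y l\<rbrakk> \<Longrightarrow> f (l + 1) (degen Y l j y) = degen Z l j (f l y)"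
    and surj: "\<And>l. f l ` obj Y l = obj Z l"
    and z: "z \<in> normalized Z l"
  shows "\<exists>u\<in>normalized Y l. f l u = z"
proof -
  interpret Y: simplicial_vector_space Y by fact
  interpret Z: simplicial_vector_space Z by fact
  have "\<exists>u\<in>obj Y l. (\<forall>i<k. face Y l i u = 0) \<and> f l u = z" if "k \<le> l" for k
    using that
  proof (induction k)
    case 0
    have "z \<in> f l ` obj Y l" using z surj[of l] by (simp add: normalized_iff)
    then show ?case by auto
  next
    case (Suc k)
    then obtain u where u: "u \<in> obj Y l" "\<forall>i<k. face Y l i u = 0" "f l u = z" by auto
    have k: "k < l" using Suc by simp
    have "f l (degen Y (l - 1) k (face Y l k u)) = degen Z (l - 1) k (face Z l k z)"
      using degen[of k "l - 1" "face Y l k u"] face[of l k u] Y.face_in[of l k u] u k by simp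
    also have "\<dots> = 0" using z k by (simp add: normalized_iff)
    finally have "f l (Y.kill_face l k u) = z"
      using u by (simp add: Y.kill_face_def linear_diff[OF f])
    then show ?case
      using u k by (intro bexI[of _ "Y.kill_face l k u"]) (auto intro!: Y.face_kill_face Y.kill_face_in)
  qed
  from this[of l] show ?thesis by (auto simp: normalized_iff)
qed

text \<open>The part \<open>H\<^sub>l\<^sub>+\<^sub>1(Y) \<rightarrow> H\<^sub>l\<^sub>+\<^sub>1(Z) \<rightarrow> H\<^sub>l(X)\<close> of the long exact sequence of
  \<open>0 \<rightarrow> X \<rightarrow> Y \<rightarrow> Z \<rightarrow> 0\<close>: the outer groups vanish, hence so does the middle one.\<close>

lemma acyclic_in_quotient:
  assumes Y: "simplicial_vector_space Y" and Z: "simplicial_vector_space Z"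
    and f: "\<And>l. linear (f l)"
    and face: "\<And>l i y. \<lbrakk>1 \<le> l; i \<le> l; y \<in> obj Y l\<rbrakk> \<Longrightarrow> f (l - 1) (face Y l i y) = face Z l i (f l y)"
    and degen: "\<And>l j y. \<lbrakk>j \<le> l; y \<in> obj Y l\<rbrakk> \<Longrightarrow> f (l + 1) (degen Y l j y) = degen Z l j (f l y)"
    and surj: "\<And>l. f l ` obj Y l = obj Z l"
    and ker: "\<And>l. obj X l = {y \<in> obj Y l. f l y = 0}" and face_X: "face X = face Y"
    and "acyclic_in Y (l + 1)" "acyclic_in X l"
  shows "acyclic_in Z (l + 1)"
  unfolding acyclic_in_def
proof (intro ballI impI)
  interpret Y: simplicial_vector_space Y by fact
  interpret Z: simplicial_vector_space Z by fact
  fix z assume z: "z \<in> normalized Z (l + 1)" "1 \<le> l + 1 \<longrightarrow> face Z (l + 1) (l + 1) z = 0"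
  obtain u where u: "u \<in> normalized Y (l + 1)" "f (l + 1) u = z"
    using lift_normalized[OF Y Z f face degen surj z(1)] by blast
  \<comment> \<open>\<open>?b\<close> represents the image of the class of \<open>z\<close> under the connecting homomorphism; if it is the
    boundary of \<open>k\<close>, then \<open>u - k\<close> is a cycle that lifts \<open>z\<close>.\<close>
  let ?b = "face Y (l + 1) (l + 1) u"
  have uobj: "u \<in> obj Y (l + 1)" using u by (simp add: normalized_iff)
  have bobj: "?b \<in> obj X l"
    using face[of "l + 1" "l + 1" u] Y.face_in[of "l + 1" "l + 1" u] uobj u(2) z(2) by (simp add: ker)
  have dd: "face Y l i ?b = 0" if "i \<le> l" "1 \<le> l" for i
    using Y.face_face[of "l + 1" i "l + 1" u] that uobj u(1) by (simp add: normalized_iff)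
  have "?b \<in> normalized X l" "1 \<le> l \<longrightarrow> face X l l ?b = 0"
    using bobj dd by (auto simp: normalized_iff face_X)
  then obtain k where k: "k \<in> normalized X (l + 1)" "face X (l + 1) (l + 1) k = ?b"
    using \<open>acyclic_in X l\<close> unfolding acyclic_in_def by blast
  have k': "k \<in> normalized Y (l + 1)" "f (l + 1) k = 0"
    using k(1) by (auto simp: normalized_iff ker face_X)
  have "u - k \<in> normalized Y (l + 1)"
    using u k' Y.subspace_normalized subspace_diff by blast
  moreover have "face Y (l + 1) (l + 1) (u - k) = 0"
    using Y.face_diff[of "l + 1" "l + 1" u k] k(2) by (simp add: face_X)
  ultimately obtain v where v: "v \<in> normalized Y (l + 2)" "face Y (l + 2) (l + 2) v = u - k"
    using \<open>acyclic_in Y (l + 1)\<close> unfolding acyclic_in_def by fastforce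
  have vobj: "v \<in> obj Y (l + 2)" using v by (simp add: normalized_iff)
  have "face Z (l + 2) i (f (l + 2) v) = f (l + 1) (face Y (l + 2) i v)" if "i \<le> l + 2" for i
    using face[of "l + 2" i v] that vobj by simp
  moreover have "f (l + 2) v \<in> obj Z (l + 2)" using vobj surj by blast
  moreover have "f (l + 1) (u - k) = z" using u k' by (simp add: linear_diff[OF f])
  ultimately show "\<exists>w\<in>normalized Z (l + 1 + 1). face Z (l + 1 + 1) (l + 1 + 1) w = z"
    using v by (intro bexI[of _ "f (l + 2) v"]) (auto simp: normalized_iff linear_0[OF f])
qed

section \<open>Path and loop objects\<close>

text \<open>Faces and degeneracies with the last index are dropped simply because the indices that are
  valid in degree \<open>l\<close> stop at \<open>l\<close>.\<close>

definition path_object :: "'a::real_vector simplicial_data \<Rightarrow> 'a simplicial_data"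
  where "path_object V =
    \<lparr>obj = (\<lambda>l. obj V (l + 1)), face = (\<lambda>l. face V (l + 1)), degen = (\<lambda>l. degen V (l + 1))\<rparr>"

text \<open>The kernel of the map from the path object to \<open>V\<close> that is given by the omitted last face.\<close>

definition loop_object :: "'a::real_vector simplicial_data \<Rightarrow> 'a simplicial_data"
  where "loop_object V =
    \<lparr>obj = (\<lambda>l. {x \<in> obj V (l + 1). face V (l + 1) (l + 1) x = 0}),
     face = (\<lambda>l. face V (l + 1)), degen = (\<lambda>l. degen V (l + 1))\<rparr>"

lemma path_object_simps [simp]:
  "obj (path_object V) l = obj V (Suc l)"
  "face (path_object V) l = face V (Suc l)"
  "degen (path_object V) l = degen V (Suc l)"
  by (simp_all add: path_object_def)

lemma loop_object_simps [simp]: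
  "obj (loop_object V) l = {x \<in> obj V (Suc l). face V (Suc l) (Suc l) x = 0}"
  "face (loop_object V) l = face V (Suc l)"
  "degen (loop_object V) l = degen V (Suc l)"
  by (simp_all add: loop_object_def)

context simplicial_vector_space
begin

lemma simplicial_vector_space_path_object: "simplicial_vector_space (path_object V)"
proof (rule simplicial_vector_space.intro, unfold path_object_simps, goal_cases)
  case 1 show ?case by (rule subspace_obj)
next
  case 2 show ?case by (rule finite_dim_obj)
next
  case 3 then show ?case by (intro linear_face) auto
next
  case (4 l i x) then show ?case using face_in[of "Suc l" i x] by simp
next
  case 5 then show ?case by (intro linear_degen) auto
next
  case (6 j l x) then show ?case using degen_in[of j "Suc l" x] by simp
next
  case (7 l i j x) then show ?case using face_face[of "Suc l" i j x] by simp
next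
  case (8 i j l x) then show ?case using degen_degen[of i j "Suc l" x] by simp
next
  case (9 i j l x) then show ?case using face_degen_less[of i j "Suc l" x] by simp
next
  case (10 j l x) then show ?case using face_degen_eq[of j "Suc l" x] by simp
next
  case (11 j l x) then show ?case using face_degen_Suc[of j "Suc l" x] by simp
next
  case (12 j i l x) then show ?case using face_degen_greater[of j i "Suc l" x] by simp
qed

text \<open>The degeneracy \<open>s\<^sub>l\<close> is a section of the omitted face \<open>d\<^sub>l\<^sub>+\<^sub>1\<close>, which gives a linear
  projection of the path object onto the loop object in each degree.\<close>

definition loop_proj :: "nat \<Rightarrow> 'a \<Rightarrow> 'a"
  where "loop_proj l x = x - degen V l l (face V (Suc l) (Suc l) x)"

lemma linear_loop_proj: "linear (loop_proj l)"
proof -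
  have "linear (\<lambda>x. degen V l l (face V (Suc l) (Suc l) x))"
    using linear_compose[OF linear_face[of "Suc l" "Suc l"] linear_degen[of l l]] by (simp add: o_def)
  then show ?thesis
    unfolding loop_proj_def by (intro linear_compose_sub linear_id[unfolded id_def])
qed

lemma loop_proj_in: "x \<in> obj V (Suc l) \<Longrightarrow> loop_proj l x \<in> obj (loop_object V) l"
  using face_in[of "Suc l" "Suc l" x] degen_in[of l l "face V (Suc l) (Suc l) x"]
    face_degen_Suc[of l l "face V (Suc l) (Suc l) x"]
  by (auto simp: loop_proj_def face_diff intro!: subspace_diff subspace_obj)

lemma loop_proj_ident: "x \<in> obj (loop_object V) l \<Longrightarrow> loop_proj l x = x"
  by (simp add: loop_proj_def)

lemma obj_loop_object: "obj (loop_object V) l = loop_proj l ` obj V (Suc l)"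
proof (intro equalityI subsetI)
  fix x assume x: "x \<in> obj (loop_object V) l"
  then show "x \<in> loop_proj l ` obj V (Suc l)"
    using loop_proj_ident[OF x] by (intro image_eqI[of x _ x]) auto
qed (use loop_proj_in in blast)

lemma simplicial_vector_space_loop_object: "simplicial_vector_space (loop_object V)"
proof -
  interpret P: simplicial_vector_space "path_object V"
    by (rule simplicial_vector_space_path_object)
  show ?thesis
  proof (rule simplicial_vector_space.intro, goal_cases)
    case 1 show ?case
      unfolding obj_loop_object by (intro linear_subspace_image linear_loop_proj subspace_obj)
  next
    case (2 l) show ?case
      using finite_dim_obj[of "Suc l"] unfolding obj_loop_object
      by (metis finite_imageI linear_span_image[OF linear_loop_proj])
  next
    case 3 then show ?case using P.linear_face by simp
  next
    case (4 l i x) then show ?case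
      using P.face_in[of l i x] face_face[of "Suc l" i "Suc l" x] by simp
  next
    case 5 then show ?case using P.linear_degen by simp
  next
    case (6 j l x) then show ?case
      using P.degen_in[of j l x] face_degen_greater[of j "Suc (Suc l)" "Suc l" x] by simp
  next
    case (7 l i j x) then show ?case using P.face_face[of l i j x] by simp
  next
    case (8 i j l x) then show ?case using P.degen_degen[of i j l x] by simp
  next
    case (9 i j l x) then show ?case using P.face_degen_less[of i j l x] by simp
  next
    case (10 j l x) then show ?case using P.face_degen_eq[of j l x] by simp
  next
    case (11 j l x) then show ?case using P.face_degen_Suc[of j l x] by simp
  next
    case (12 j i l x) then show ?case using P.face_degen_greater[of j i l x] by simp
  qed
qed

text \<open>Let \<open>x\<close> be normalized in the loop object, so all its faces in \<open>V\<close> but \<open>d\<^sub>l x\<close> vanish. Then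
  \<open>x - s\<^sub>l d\<^sub>l x\<close> is normalized in \<open>V\<close>, hence zero, and applying \<open>d\<^sub>l\<^sub>+\<^sub>1\<close> to \<open>x = s\<^sub>l d\<^sub>l x\<close> yields
  \<open>0 = d\<^sub>l x\<close>.\<close>

lemma normalized_loop_object_zero:
  assumes "normalized V (Suc l) = {0}"
  shows "normalized (loop_object V) l = {0}"
proof -
  have "x = 0" if x: "x \<in> normalized (loop_object V) l" for x
  proof -
    have xo: "x \<in> obj V (Suc l)" "face V (Suc l) (Suc l) x = 0" "\<forall>i<l. face V (Suc l) i x = 0"
      using x by (auto simp: normalized_iff)
    let ?d = "face V (Suc l) l x"
    have "kill_face (Suc l) l x \<in> normalized V (Suc l)"
      using xo by (auto simp: normalized_iff less_Suc_eq_le intro!: face_kill_face kill_face_in)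
    then have eq: "x = degen V l l ?d"
      using assms by (simp add: kill_face_def)
    have "?d \<in> obj V l" using face_in[of "Suc l" l x] xo by simp
    then have "face V (Suc l) (Suc l) (degen V l l ?d) = ?d"
      using face_degen_Suc[of l l ?d] by simp
    then have "?d = 0" using xo eq by simp
    then show ?thesis using eq by simp
  qed
  moreover have "0 \<in> normalized (loop_object V) l"
    by (simp add: normalized_iff)
  ultimately show ?thesis by blast
qed

text \<open>The degeneracy \<open>s\<^sub>l\<^sub>+\<^sub>1\<close> that the path object omits is a contraction: it sends a cycle to a
  simplex that bounds it. In degree zero the homology is \<open>V\<^sub>0\<close>.\<close>

lemma acyclic_in_path_object:
  assumes "1 \<le> l"
  shows "acyclic_in (path_object V) l"
  unfolding acyclic_in_def
proof (intro ballI impI)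
  fix z assume z: "z \<in> normalized (path_object V) l" "1 \<le> l \<longrightarrow> face (path_object V) l l z = 0"
  then have zo: "z \<in> obj V (Suc l)" and d: "\<And>i. i \<le> l \<Longrightarrow> face V (Suc l) i z = 0"
    using assms by (auto simp: normalized_iff le_less)
  show "\<exists>w\<in>normalized (path_object V) (l + 1). face (path_object V) (l + 1) (l + 1) w = z"
  proof
    show "face (path_object V) (l + 1) (l + 1) (degen V (Suc l) (Suc l) z) = z"
      using face_degen_eq[of "Suc l" "Suc l" z] zo by simp
    show "degen V (Suc l) (Suc l) z \<in> normalized (path_object V) (l + 1)"
      using degen_in[of "Suc l" "Suc l" z] face_degen_less[of _ "Suc l" "Suc l" z] zo d
      by (auto simp: normalized_iff)
  qed
qed

lemma obj_zero:
  assumes "\<And>l. normalized V l = {0}"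
  shows "obj V l = {0}"
proof (induction l)
  case 0
  show ?case using assms[of 0] by (simp add: normalized_def)
next
  case (Suc l)
  have "x = 0" if "x \<in> obj V (Suc l)" for x
  proof -
    have "x \<in> span (\<Union>j<Suc l. degen V l j ` obj V l)"
      using decompose_normalized_degenerate[OF that] assms by simp
    also have "(\<Union>j<Suc l. degen V l j ` obj V l) = {0}"
      using Suc by auto
    finally show ?thesis by simp
  qed
  then show ?case by auto
qed

end

section \<open>Tensor products\<close>

lemma tensor_product_simps [simp]:
  "obj (tensor_product V W) l = tensor_space (obj V l) (obj W l)"
  "face (tensor_product V W) l i = tensor_map (face V l i) (face W l i)"
  "degen (tensor_product V W) l j = tensor_map (degen V l j) (degen W l j)"
  by (simp_all add: tensor_product_def)

lemma linear_eq_on_pure_tensors: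
  assumes "linear f" "linear g" "\<And>x y. f (pure_tensor x y) = g (pure_tensor x y)"
  shows "f t = g t"
proof (rule linear_eq_on[OF assms(1,2)])
  show "t \<in> span {pure_tensor x y | x y. True}"
    unfolding span_pure_tensors by (rule UNIV_I)
qed (use assms in auto)

text \<open>If \<open>s\<close> is a section of \<open>d\<close>, this shows that the kernel of \<open>d \<otimes> 1\<close> is the tensor product with the
  kernel of \<open>d\<close>: on the kernel of \<open>d \<otimes> 1\<close> the right-hand side is \<open>t\<close>.\<close>

lemma tensor_map_retract_kernel:
  assumes d: "linear d" and s: "linear s"
  shows "tensor_map (\<lambda>x. x - s (d x)) id t = t - tensor_map s id (tensor_map d id t)"
proof (rule linear_eq_on_pure_tensors[where f = "tensor_map (\<lambda>x. x - s (d x)) id"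
      and g = "\<lambda>t. t - tensor_map s id (tensor_map d id t)"])
  have lin: "linear (\<lambda>x. x - s (d x))"
    using linear_compose_sub[OF linear_id linear_compose[OF d s]] by (simp add: o_def)
  show "linear (tensor_map (\<lambda>x. x - s (d x)) id)"
    by (intro linear_tensor_map lin linear_id)
  show "linear (\<lambda>t. t - tensor_map s id (tensor_map d id t))"
    using linear_compose_sub[OF linear_id
        linear_compose[OF linear_tensor_map[OF d linear_id] linear_tensor_map[OF s linear_id]]]
    by (simp add: o_def)
  fix x y
  have "pure_tensor (x - s (d x)) y = pure_tensor x y - pure_tensor (s (d x)) y"
    by (rule bilinear_lsub[OF bilinear_pure_tensor])
  then show "tensor_map (\<lambda>x. x - s (d x)) id (pure_tensor x y)
      = pure_tensor x y - tensor_map s id (tensor_map d id (pure_tensor x y))"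
    by (simp add: tensor_map_pure lin d s linear_id)
qed

lemma tensor_space_mono: "A \<subseteq> A' \<Longrightarrow> B \<subseteq> B' \<Longrightarrow> tensor_space A B \<subseteq> tensor_space A' B'"
  unfolding tensor_space_def by (intro span_mono) blast

text \<open>The inductive step of the proof: the long exact sequence of
  \<open>KV \<otimes> W \<rightarrow> PV \<otimes> W \<rightarrow> V \<otimes> W\<close>, where \<open>KV\<close> and \<open>PV\<close> are the loop and the path object. The
  section \<open>s\<^sub>l\<close> of the last face gives surjectivity and identifies the kernel.\<close>

lemma acyclic_in_tensor_path:
  assumes V: "simplicial_vector_space V" and W: "simplicial_vector_space W"
    and "acyclic_in (tensor_product (path_object V) W) (l + 1)"
    and "acyclic_in (tensor_product (loop_object V) W) l"
  shows "acyclic_in (tensor_product V W) (l + 1)"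
proof -
  interpret V: simplicial_vector_space V by fact
  interpret W: simplicial_vector_space W by fact
  define f where "f l = tensor_map (face V (Suc l) (Suc l)) (id :: 'b \<Rightarrow> 'b)" for l
  define s where "s l = tensor_map (degen V l l) (id :: 'b \<Rightarrow> 'b)" for l
  have lin_d: "linear (face V (Suc l) (Suc l))" and lin_s: "linear (degen V l l)" for l
    using V.linear_face V.linear_degen by auto
  have lin_f: "linear (f l)" for l
    unfolding f_def by (intro linear_tensor_map linear_id lin_d)
  have f_in: "f l t \<in> tensor_space (obj V l) (obj W l)"
    if "t \<in> tensor_space (obj V (Suc l)) (obj W l)" for l t
    unfolding f_def using V.face_in[of "Suc l" "Suc l"]
    by (intro tensor_map_in[OF lin_d linear_id _ _ that]) auto
  have fs: "f l (s l t) = t" and s_in: "s l t \<in> tensor_space (obj V (Suc l)) (obj W l)"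
    if "t \<in> tensor_space (obj V l) (obj W l)" for l t
    unfolding f_def s_def using V.face_degen_Suc[of l l] V.degen_in[of l l]
    by (auto intro!: tensor_map_comp_id[OF lin_d linear_id lin_s linear_id _ _ that]
        tensor_map_in[OF lin_s linear_id _ _ that])
  show ?thesis
  proof (rule acyclic_in_quotient[of "tensor_product (path_object V) W" _ f
        "tensor_product (loop_object V) W"])
    show "simplicial_vector_space (tensor_product (path_object V) W)"
      by (intro simplicial_vector_space_tensor_product V.simplicial_vector_space_path_object W)
    show "simplicial_vector_space (tensor_product V W)"
      by (intro simplicial_vector_space_tensor_product V W)
    show "linear (f l)" for l by (rule lin_f)
    show "f (l - 1) (face (tensor_product (path_object V) W) l i t)
        = face (tensor_product V W) l i (f l t)"
      if "1 \<le> l" "i \<le> l" "t \<in> obj (tensor_product (path_object V) W) l" for l i t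
      unfolding f_def tensor_product_simps path_object_simps
      using that V.face_face[of "Suc l" i "Suc l"]
      by (intro tensor_map_comp_eq[where A = "obj V (Suc l)" and B = "obj W l"]
          V.linear_face W.linear_face linear_id) auto
    show "f (l + 1) (degen (tensor_product (path_object V) W) l j t)
        = degen (tensor_product V W) l j (f l t)"
      if "j \<le> l" "t \<in> obj (tensor_product (path_object V) W) l" for l j t
      unfolding f_def tensor_product_simps path_object_simps
      using that V.face_degen_greater[of j "Suc (Suc l)" "Suc l"]
      by (intro tensor_map_comp_eq[where A = "obj V (Suc l)" and B = "obj W l"]
          V.linear_face V.linear_degen W.linear_degen linear_id) auto
    show "f l ` obj (tensor_product (path_object V) W) l = obj (tensor_product V W) l" for l
    proof (intro equalityI subsetI)
      fix t assume "t \<in> obj (tensor_product V W) l"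
      then show "t \<in> f l ` obj (tensor_product (path_object V) W) l"
        using fs[of t l] s_in[of t l] by (auto intro!: image_eqI[of t _ "s l t"])
    qed (use f_in in auto)
    show "obj (tensor_product (loop_object V) W) l
        = {t \<in> obj (tensor_product (path_object V) W) l. f l t = 0}" for l
    proof (intro equalityI subsetI CollectI conjI)
      fix t assume t: "t \<in> obj (tensor_product (loop_object V) W) l"
      then show "t \<in> obj (tensor_product (path_object V) W) l"
        using tensor_space_mono[of "obj (loop_object V) l" "obj (path_object V) l" "obj W l" "obj W l"]
        by auto
      show "f l t = 0"
      proof (rule linear_eq_0_on_span[OF lin_f])
        show "t \<in> span {pure_tensor x y | x y. x \<in> obj (loop_object V) l \<and> y \<in> obj W l}"
          using t by (simp add: tensor_space_def)
      qed (auto simp: f_def tensor_map_pure lin_d linear_id bilinear_lzero[OF bilinear_pure_tensor])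
    next
      fix t assume t: "t \<in> {t \<in> obj (tensor_product (path_object V) W) l. f l t = 0}"
      have "tensor_map (V.loop_proj l) id t = t - s l (f l t)"
        using tensor_map_retract_kernel[OF lin_d lin_s]
        by (simp add: s_def f_def V.loop_proj_def[abs_def])
      then have "t = tensor_map (V.loop_proj l) id t"
        using t by (simp add: s_def linear_0[OF linear_tensor_map] lin_s linear_id)
      also have "\<dots> \<in> tensor_space (obj (loop_object V) l) (obj W l)"
        using t V.loop_proj_in
        by (intro tensor_map_in[of _ _ "obj V (Suc l)" _ "obj W l"] V.linear_loop_proj linear_id) auto
      finally show "t \<in> obj (tensor_product (loop_object V) W) l" by simp
    qed
    show "face (tensor_product (loop_object V) W) = face (tensor_product (path_object V) W)"
      by (intro ext) simp
  qed fact+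
qed

definition tensor_swap :: "('a::real_vector, 'b::real_vector) tensor \<Rightarrow> ('b, 'a) tensor"
  where "tensor_swap = tensor_lift (\<lambda>x y. pure_tensor y x)"

lemma bilinear_swap: "bilinear h \<Longrightarrow> bilinear (\<lambda>x y. h y x)"
  by (auto simp: bilinear_def)

lemma linear_tensor_swap: "linear tensor_swap"
  unfolding tensor_swap_def by (rule linear_tensor_lift[OF bilinear_swap[OF bilinear_pure_tensor]])

lemma tensor_swap_pure [simp]: "tensor_swap (pure_tensor x y) = pure_tensor y x"
  unfolding tensor_swap_def by (rule tensor_lift_pure[OF bilinear_swap[OF bilinear_pure_tensor]])

lemma tensor_swap_swap [simp]: "tensor_swap (tensor_swap t) = t"
proof -
  have "(tensor_swap \<circ> tensor_swap) t = id t"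
    by (rule linear_eq_on_pure_tensors[where f = "tensor_swap \<circ> tensor_swap" and g = id])
      (auto intro: linear_compose linear_tensor_swap linear_id)
  then show ?thesis by simp
qed

lemma tensor_swap_map:
  assumes "linear f" "linear g"
  shows "tensor_swap (tensor_map f g t) = tensor_map g f (tensor_swap t)"
proof -
  have "(tensor_swap \<circ> tensor_map f g) t = (tensor_map g f \<circ> tensor_swap) t"
    by (rule linear_eq_on_pure_tensors[where f = "tensor_swap \<circ> tensor_map f g"
          and g = "tensor_map g f \<circ> tensor_swap"])
      (auto simp: tensor_map_pure assms intro!: linear_compose linear_tensor_swap linear_tensor_map)
  then show ?thesis by simp
qed

lemma tensor_swap_in:
  assumes "t \<in> tensor_space A B"
  shows "tensor_swap t \<in> tensor_space B A"
proof -
  have "tensor_swap ` {pure_tensor x y | x y. x \<in> A \<and> y \<in> B}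
      \<subseteq> {pure_tensor x y | x y. x \<in> B \<and> y \<in> A}" by force
  then show ?thesis
    using assms linear_span_image[OF linear_tensor_swap] span_mono
    unfolding tensor_space_def by blast
qed

lemma acyclic_in_tensor_commute:
  assumes V: "simplicial_vector_space V" and W: "simplicial_vector_space W"
    and VW: "acyclic_in (tensor_product V W) l"
  shows "acyclic_in (tensor_product W V) l"
  unfolding acyclic_in_def
proof (intro ballI impI)
  interpret V: simplicial_vector_space V by fact
  interpret W: simplicial_vector_space W by fact
  have face: "face (tensor_product V W) l i (tensor_swap t)
      = tensor_swap (face (tensor_product W V) l i t)"
    "face (tensor_product W V) l i (tensor_swap t')
      = tensor_swap (face (tensor_product V W) l i t')" if "1 \<le> l" "i \<le> l" for l i t t'
    using that by (simp_all add: tensor_swap_map V.linear_face W.linear_face)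
  have norm: "tensor_swap t \<in> normalized (tensor_product V W) l"
    if "t \<in> normalized (tensor_product W V) l" for l t
    using that face(1)[of l _ t]
    by (auto simp: normalized_iff linear_0[OF linear_tensor_swap] tensor_swap_in
        simp del: tensor_product_simps(2))
  have norm': "tensor_swap t \<in> normalized (tensor_product W V) l"
    if "t \<in> normalized (tensor_product V W) l" for l t
    using that face(2)[of l _ t]
    by (auto simp: normalized_iff linear_0[OF linear_tensor_swap] tensor_swap_in
        simp del: tensor_product_simps(2))
  fix z assume z: "z \<in> normalized (tensor_product W V) l"
    "1 \<le> l \<longrightarrow> face (tensor_product W V) l l z = 0"
  then have "1 \<le> l \<longrightarrow> face (tensor_product V W) l l (tensor_swap z) = 0"
    using face(1)[of l l z] by (auto simp: linear_0[OF linear_tensor_swap])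
  then obtain w where w: "w \<in> normalized (tensor_product V W) (l + 1)"
    "face (tensor_product V W) (l + 1) (l + 1) w = tensor_swap z"
    using VW norm[OF z(1)] unfolding acyclic_in_def by blast
  show "\<exists>w\<in>normalized (tensor_product W V) (l + 1).
      face (tensor_product W V) (l + 1) (l + 1) w = z"
    using face(2)[of "l + 1" "l + 1" w] w(2) norm'[OF w(1)]
    by (intro bexI[of _ "tensor_swap w"]) (auto simp del: tensor_product_simps)
qed

section \<open>The homotopy type\<close>

text \<open>Induction on the degree \<open>n\<close> from which on \<open>N(V)\<close> vanishes; passing to the loop object lowers both
  \<open>n\<close> and the degree by one. For \<open>n = 0\<close> the whole of \<open>V\<close> is zero, so that the bound may start at
  \<open>l = r\<close>; in the step \<open>l \<ge> n + 1 + r > r\<close>. Without this gain of one degree the two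
  applications below would not add up to the bound \<open>n + m\<close>.\<close>

lemma acyclic_in_tensor_product_if_path:
  fixes V :: "'a::real_vector simplicial_data" and W :: "'b::real_vector simplicial_data"
  assumes W: "simplicial_vector_space W"
    and path: "\<And>(V' :: 'a simplicial_data) l. \<lbrakk>simplicial_vector_space V'; r < l\<rbrakk> \<Longrightarrow>
      acyclic_in (tensor_product (path_object V') W) l"
  shows "\<lbrakk>simplicial_vector_space V; \<And>k. n \<le> k \<Longrightarrow> normalized V k = {0}; n + r \<le> l\<rbrakk> \<Longrightarrow>
    acyclic_in (tensor_product V W) l"
proof (induction n arbitrary: V l)
  case 0
  interpret V: simplicial_vector_space V by fact
  interpret T: simplicial_vector_space "tensor_product V W"
    by (intro simplicial_vector_space_tensor_product W) fact
  have "obj V k = {0}" for k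
    by (rule V.obj_zero) (use 0 in auto)
  then have "{pure_tensor x y | x y. x \<in> obj V k \<and> y \<in> obj W k} \<subseteq> {0}" for k
    by (auto simp: bilinear_lzero[OF bilinear_pure_tensor])
  from span_mono[OF this] have "tensor_space (obj V k) (obj W k) \<subseteq> {0}" for k
    by (simp add: tensor_space_def)
  then have "normalized (tensor_product V W) k \<subseteq> {0}" for k
    by (force simp: normalized_iff)
  then have "z = 0" if "z \<in> normalized (tensor_product V W) l" for z using that by blast
  moreover have "0 \<in> normalized (tensor_product V W) (l + 1)"
    using T.subspace_normalized subspace_0 by blast
  moreover have "face (tensor_product V W) (l + 1) (l + 1) 0 = 0"
    by (rule T.face_zero) auto
  ultimately show ?case unfolding acyclic_in_def by blast
next
  case (Suc n)
  interpret V: simplicial_vector_space V by fact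
  obtain l' where l: "l = l' + 1" using Suc.prems(3) by (cases l) auto
  have "acyclic_in (tensor_product (loop_object V) W) l'"
  proof (rule Suc.IH)
    show "simplicial_vector_space (loop_object V)" by (rule V.simplicial_vector_space_loop_object)
    show "normalized (loop_object V) k = {0}" if "n \<le> k" for k
      using that by (intro V.normalized_loop_object_zero Suc.prems(2)) auto
    show "n + r \<le> l'" using Suc.prems(3) l by simp
  qed
  moreover have "acyclic_in (tensor_product (path_object V) W) l"
    using Suc.prems by (intro path) auto
  ultimately show ?case
    using acyclic_in_tensor_path[OF Suc.prems(1) W, of l'] by (simp add: l)
qed

text \<open>Both factors drop the same face, so \<open>PV \<otimes> PW\<close> and \<open>P(V \<otimes> W)\<close> have the same data.\<close>

lemma path_object_tensor:
  "acyclic_in (tensor_product (path_object V) (path_object W)) l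
    = acyclic_in (path_object (tensor_product V W)) l"
  by (simp add: acyclic_in_def normalized_def)

text \<open>The induction is used twice. On the order of \<open>W\<close>, it starts from \<open>PW' \<otimes> PV'\<close>, which is
  acyclic in positive degrees, and shows that \<open>PV' \<otimes> W\<close> is acyclic above \<open>m\<close>; on the order of
  \<open>V\<close>, it goes on to \<open>V \<otimes> W\<close>.\<close>

lemma acyclic_in_tensor_product:
  fixes V :: "'a::real_vector simplicial_data" and W :: "'b::real_vector simplicial_data"
  assumes V: "simplicial_vector_space V" "\<And>k. n < k \<Longrightarrow> normalized V k = {0}"
    and W: "simplicial_vector_space W" "\<And>k. m < k \<Longrightarrow> normalized W k = {0}"
    and l: "n + m < l"
  shows "acyclic_in (tensor_product V W) l"
proof -
  have path_W: "acyclic_in (tensor_product W (path_object V')) l"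
    if V': "simplicial_vector_space V'" and "m < l" for V' :: "'a simplicial_data" and l
  proof (rule acyclic_in_tensor_product_if_path[where r = 0 and n = "Suc m"])
    show "simplicial_vector_space (path_object V')"
      using V' by (rule simplicial_vector_space.simplicial_vector_space_path_object)
    show "acyclic_in (tensor_product (path_object W') (path_object V')) l"
      if "simplicial_vector_space W'" "0 < l" for W' :: "'b simplicial_data" and l
      unfolding path_object_tensor using that V'
      by (intro simplicial_vector_space.acyclic_in_path_object simplicial_vector_space_tensor_product) auto
  qed (use W that in auto)
  show ?thesis
  proof (rule acyclic_in_tensor_product_if_path[where r = m and n = "Suc n"])
    show "acyclic_in (tensor_product (path_object V') W) l"
      if "simplicial_vector_space V'" "m < l" for V' :: "'a simplicial_data" and l
      using path_W[OF that] that
      by (intro acyclic_in_tensor_commute[OF W(1)]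
          simplicial_vector_space.simplicial_vector_space_path_object)
  qed (use V W l in auto)
qed

section \<open>The order\<close>

context simplicial_vector_space
begin

text \<open>A form of the fact that nonzero normalized simplices are not degenerate. Start with any functional
  that is \<open>1\<close> at \<open>x\<close> and precompose it with \<open>1 - s\<^sub>k d\<^sub>k\<close> for \<open>k = l - 1, \<dots>, 0\<close>. This does not change the
  value at \<open>x\<close>, as \<open>d\<^sub>k x = 0\<close>. It kills \<open>s\<^sub>k a\<close>, and it maps \<open>s\<^sub>j a\<close> with \<open>j > k\<close> to the image of
  \<open>s\<^sub>j\<close>, where the previous functional vanishes, since \<open>s\<^sub>k d\<^sub>k s\<^sub>j a = s\<^sub>k s\<^sub>j\<^sub>-\<^sub>1 d\<^sub>k a = s\<^sub>j s\<^sub>k d\<^sub>k a\<close>.\<close>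

lemma nondegenerate_functional:
  assumes x: "x \<in> normalized V l" "x \<noteq> 0"
  shows "\<exists>\<phi> :: 'a \<Rightarrow> real. linear \<phi> \<and> \<phi> x = 1 \<and>
    (\<forall>j<l. \<forall>a\<in>obj V (l - 1). \<phi> (degen V (l - 1) j a) = 0)"
proof -
  have "\<exists>\<phi> :: 'a \<Rightarrow> real. linear \<phi> \<and> \<phi> x = 1 \<and>
      (\<forall>j. k \<le> j \<and> j < l \<longrightarrow> (\<forall>a\<in>obj V (l - 1). \<phi> (degen V (l - 1) j a) = 0))" if "k \<le> l" for k
    using that
  proof (induction k rule: inc_induct)
    case base
    have ind: "independent {x}" using x by simp
    show ?case
      using linear_construct[OF ind, of "\<lambda>_. 1::real"] construct_basis[OF ind, of x "\<lambda>_. 1::real"]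
      by (intro exI[of _ "construct {x} (\<lambda>_. 1)"]) auto
  next
    case (step k)
    then obtain \<phi> :: "'a \<Rightarrow> real" where \<phi>: "linear \<phi>" "\<phi> x = 1"
      "\<And>j a. \<lbrakk>Suc k \<le> j; j < l; a \<in> obj V (l - 1)\<rbrakk> \<Longrightarrow> \<phi> (degen V (l - 1) j a) = 0" by blast
    note k = \<open>k < l\<close>
    have "\<phi> (kill_face l k (degen V (l - 1) j a)) = 0"
      if j: "k \<le> j" "j < l" and a: "a \<in> obj V (l - 1)" for j a
    proof (cases "j = k")
      case True
      then show ?thesis
        using face_degen_eq[of k "l - 1" a] a k by (simp add: kill_face_def linear_0[OF \<phi>(1)])
    next
      case False
      then have kj: "k < j" using j by simp
      let ?b = "degen V (l - 2) k (face V (l - 1) k a)"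
      have "face V (l - 1) k a \<in> obj V (l - 2)"
        using face_in[of "l - 1" k a] a kj j by (simp add: numeral_2_eq_2)
      moreover from this have b: "?b \<in> obj V (l - 1)"
        using degen_in[of k "l - 2" "face V (l - 1) k a"] kj j by (simp add: Suc_diff_Suc numeral_2_eq_2)
      moreover have "face V l k (degen V (l - 1) j a) = degen V (l - 2) (j - 1) (face V (l - 1) k a)"
        using face_degen_less[of k j "l - 1" a] a kj j by (simp add: numeral_2_eq_2)
      ultimately have "degen V (l - 1) k (face V l k (degen V (l - 1) j a)) = degen V (l - 1) j ?b"
        using degen_degen[of k "j - 1" "l - 2" "face V (l - 1) k a"] kj j
        by (simp add: Suc_diff_Suc numeral_2_eq_2)
      then show ?thesis
        using \<phi>(3)[of j a] \<phi>(3)[of j ?b] a b kj j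
        by (simp add: kill_face_def linear_diff[OF \<phi>(1)])
    qed
    moreover have "\<phi> (kill_face l k x) = 1"
      using x k \<phi>(2) by (simp add: kill_face_def normalized_iff)
    moreover have "linear (\<lambda>a. \<phi> (kill_face l k a))"
      using linear_compose[OF linear_kill_face[OF k] \<phi>(1)] by (simp add: o_def)
    ultimately show ?case
      by (intro exI[of _ "\<lambda>a. \<phi> (kill_face l k a)"]) auto
  qed
  from this[of 0] show ?thesis by auto
qed

text \<open>Composition of a functional that kills degenerate simplices with the front face
  \<open>d\<^sub>n\<^sub>+\<^sub>1 \<dots> d\<^sub>n\<^sub>+\<^sub>k\<close>, which commutes with \<open>s\<^sub>j\<close> for \<open>j < n\<close>.\<close>

lemma front_functional:
  assumes "normalized V n \<noteq> {0}"
  shows "\<exists>\<phi> :: 'a \<Rightarrow> real. linear \<phi> \<and> (\<exists>x\<in>obj V (n + k). \<phi> x = 1) \<and>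
    (\<forall>j<n. \<forall>a\<in>obj V (n + k - 1). \<phi> (degen V (n + k - 1) j a) = 0)"
proof (induction k)
  case 0
  have "0 \<in> normalized V n" using subspace_normalized subspace_0 by blast
  then obtain x where "x \<in> normalized V n" "x \<noteq> 0" using assms by blast
  with nondegenerate_functional[OF this] show ?case by (auto simp: normalized_iff)
next
  case (Suc k)
  then obtain \<phi> :: "'a \<Rightarrow> real" and x where \<phi>: "linear \<phi>" "x \<in> obj V (n + k)" "\<phi> x = 1"
    "\<And>j a. \<lbrakk>j < n; a \<in> obj V (n + k - 1)\<rbrakk> \<Longrightarrow> \<phi> (degen V (n + k - 1) j a) = 0" by blast
  let ?d = "face V (Suc (n + k)) (Suc (n + k))"
  have "\<phi> (?d (degen V (n + k) j a)) = 0" if "j < n" "a \<in> obj V (n + k)" for j a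
    using face_degen_greater[of j "Suc (n + k)" "n + k" a] face_in[of "n + k" "n + k" a] that \<phi>(4)
    by simp
  moreover have "degen V (n + k) (n + k) x \<in> obj V (n + Suc k)"
    "?d (degen V (n + k) (n + k) x) = x"
    using degen_in[of "n + k" "n + k" x] face_degen_Suc[of "n + k" "n + k" x] \<phi>(2) by auto
  moreover have "linear (\<lambda>a. \<phi> (?d a))"
    using linear_compose[OF linear_face \<phi>(1)] by (simp add: o_def)
  ultimately show ?case
    using \<phi>(3) by (intro exI[of _ "\<lambda>a. \<phi> (?d a)"] conjI bexI[of _ "degen V (n + k) (n + k) x"]) auto
qed

text \<open>Composition of a functional that kills degenerate simplices with the back face
  \<open>d\<^sub>0\<^sup>k\<close>, which turns \<open>s\<^sub>j\<close> for \<open>j \<ge> k\<close> into \<open>s\<^sub>j\<^sub>-\<^sub>k\<close>.\<close>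

lemma back_functional:
  assumes "normalized V n \<noteq> {0}"
  shows "\<exists>\<phi> :: 'a \<Rightarrow> real. linear \<phi> \<and> (\<exists>x\<in>obj V (n + k). \<phi> x = 1) \<and>
    (\<forall>j. k \<le> j \<and> j < n + k \<longrightarrow> (\<forall>a\<in>obj V (n + k - 1). \<phi> (degen V (n + k - 1) j a) = 0))"
proof (induction k)
  case 0
  have "0 \<in> normalized V n" using subspace_normalized subspace_0 by blast
  then obtain x where "x \<in> normalized V n" "x \<noteq> 0" using assms by blast
  with nondegenerate_functional[OF this] show ?case by (auto simp: normalized_iff)
next
  case (Suc k)
  then obtain \<phi> :: "'a \<Rightarrow> real" and x where \<phi>: "linear \<phi>" "x \<in> obj V (n + k)" "\<phi> x = 1"
    "\<And>j a. \<lbrakk>k \<le> j; j < n + k; a \<in> obj V (n + k - 1)\<rbrakk> \<Longrightarrow> \<phi> (degen V (n + k - 1) j a) = 0"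
    by blast
  let ?d = "face V (Suc (n + k)) 0"
  have "\<phi> (?d (degen V (n + k) j a)) = 0"
    if "Suc k \<le> j" "j < Suc (n + k)" "a \<in> obj V (n + k)" for j a
  proof -
    have "?d (degen V (n + k) j a) = degen V (n + k - 1) (j - 1) (face V (n + k) 0 a)"
      using face_degen_less[of 0 j "n + k" a] that by simp
    also have "\<phi> \<dots> = 0"
      using face_in[of "n + k" 0 a] that by (intro \<phi>(4)) auto
    finally show ?thesis .
  qed
  moreover have "degen V (n + k) 0 x \<in> obj V (n + Suc k)" "?d (degen V (n + k) 0 x) = x"
    using degen_in[of 0 "n + k" x] face_degen_eq[of 0 "n + k" x] \<phi>(2) by auto
  moreover have "linear (\<lambda>a. \<phi> (?d a))"
    using linear_compose[OF linear_face \<phi>(1)] by (simp add: o_def)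
  ultimately show ?case
    using \<phi>(3) by (intro exI[of _ "\<lambda>a. \<phi> (?d a)"] conjI bexI[of _ "degen V (n + k) 0 x"]) auto
qed

end

text \<open>Otherwise every simplex of degree \<open>n + m\<close> would be a sum of degenerate ones, on which the tensor
  product of a front functional and a back functional vanishes.\<close>

lemma normalized_tensor_product_nonzero:
  assumes V: "simplicial_vector_space V" "normalized V n \<noteq> {0}"
    and W: "simplicial_vector_space W" "normalized W m \<noteq> {0}"
  shows "normalized (tensor_product V W) (n + m) \<noteq> {0}"
proof
  assume zero: "normalized (tensor_product V W) (n + m) = {0}"
  interpret V: simplicial_vector_space V by fact
  interpret W: simplicial_vector_space W by fact
  interpret T: simplicial_vector_space "tensor_product V W"
    by (intro simplicial_vector_space_tensor_product V W)
  let ?l = "n + m"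
  obtain \<phi> :: "'a \<Rightarrow> real" and x where \<phi>: "linear \<phi>" "x \<in> obj V ?l" "\<phi> x = 1"
    "\<And>j a. \<lbrakk>j < n; a \<in> obj V (?l - 1)\<rbrakk> \<Longrightarrow> \<phi> (degen V (?l - 1) j a) = 0"
    using V.front_functional[OF V(2), of m] by blast
  obtain \<psi> :: "'b \<Rightarrow> real" and y where \<psi>: "linear \<psi>" "y \<in> obj W ?l" "\<psi> y = 1"
    "\<And>j b. \<lbrakk>n \<le> j; j < ?l; b \<in> obj W (?l - 1)\<rbrakk> \<Longrightarrow> \<psi> (degen W (?l - 1) j b) = 0"
    using W.back_functional[OF W(2), of n] by (auto simp: add.commute)
  have bil: "bilinear (\<lambda>x y. \<phi> x * \<psi> y)"
    using \<phi>(1) \<psi>(1) by (auto simp: bilinear_def linear_iff algebra_simps)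
  \<comment> \<open>The front functional kills \<open>s\<^sub>j (a \<otimes> b)\<close> for \<open>j < n\<close>, the back functional for \<open>j \<ge> n\<close>.\<close>
  let ?\<chi> = "tensor_lift (\<lambda>x y. \<phi> x * \<psi> y)"
  have deg: "?\<chi> (tensor_map (degen V (?l - 1) j) (degen W (?l - 1) j) t) = 0"
    if j: "j < ?l" and t: "t \<in> tensor_space (obj V (?l - 1)) (obj W (?l - 1))" for j t
  proof -
    have lin: "linear (degen V (?l - 1) j)" "linear (degen W (?l - 1) j)"
      using j V.linear_degen[of j "?l - 1"] W.linear_degen[of j "?l - 1"] by auto
    have "(?\<chi> \<circ> tensor_map (degen V (?l - 1) j) (degen W (?l - 1) j)) t = 0"
    proof (rule linear_eq_0_on_span[OF _ _ t[unfolded tensor_space_def]])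
      show "linear (?\<chi> \<circ> tensor_map (degen V (?l - 1) j) (degen W (?l - 1) j))"
        by (intro linear_compose linear_tensor_map linear_tensor_lift bil lin)
      fix u assume "u \<in> {pure_tensor a b | a b. a \<in> obj V (?l - 1) \<and> b \<in> obj W (?l - 1)}"
      then show "(?\<chi> \<circ> tensor_map (degen V (?l - 1) j) (degen W (?l - 1) j)) u = 0"
        using j \<phi>(4)[of j] \<psi>(4)[of j]
        by (cases "j < n") (auto simp: tensor_map_pure lin tensor_lift_pure[OF bil] simp del: One_nat_def)
    qed
    then show ?thesis by simp
  qed
  have "pure_tensor x y \<in> obj (tensor_product V W) ?l"
    using \<phi>(2) \<psi>(2) by (auto simp: tensor_space_def intro!: span_base)
  then have "pure_tensor x y \<in> span (\<Union>j<?l. degen (tensor_product V W) (?l - 1) j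
      ` obj (tensor_product V W) (?l - 1))"
    using T.decompose_normalized_degenerate[of "pure_tensor x y" ?l] zero by simp
  then have "?\<chi> (pure_tensor x y) = 0"
    by (rule linear_eq_0_on_span[OF linear_tensor_lift[OF bil], rotated])
      (auto simp: deg simp del: One_nat_def)
  then show False using \<phi>(3) \<psi>(3) by (simp add: tensor_lift_pure[OF bil])
qed

theorem theorem3p16:
  fixes V :: "'a::real_vector simplicial_data" and W :: "'b::real_vector simplicial_data"
    and n m :: nat
  assumes "VS_groupoid n V" and "has_order V n"
    and "VS_groupoid m W" and "has_order W m"
  shows "order_at_least (tensor_product V W) (n + m) \<and>
    homotopy_type_at_most (tensor_product V W) (n + m)"
proof
  have V: "simplicial_vector_space V" and W: "simplicial_vector_space W"
    using assms by (auto simp: VS_groupoid_def)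
  have zero_V: "normalized V k = {0}" if "n < k" for k
    using assms(2) that unfolding has_order_def by (meson leD)
  have zero_W: "normalized W k = {0}" if "m < k" for k
    using assms(4) that unfolding has_order_def by (meson leD)
  show "order_at_least (tensor_product V W) (n + m)"
    unfolding order_at_least_def
  proof (intro exI conjI)
    show "normalized (tensor_product V W) (n + m) \<noteq> {0}"
      using assms(2,4) by (intro normalized_tensor_product_nonzero V W) (simp_all add: has_order_def)
  qed simp
  show "homotopy_type_at_most (tensor_product V W) (n + m)"
    unfolding homotopy_type_at_most_def
  proof (intro allI impI)
    fix l assume "n + m < l"
    then have "acyclic_in (tensor_product V W) l"
      using acyclic_in_tensor_product[OF V zero_V W zero_W] by blast
    then show "homology (tensor_product V W) l = {boundaries (tensor_product V W) l}"
      by (rule simplicial_vector_space.homology_eq_zero[OF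
            simplicial_vector_space_tensor_product[OF V W]])
  qed
qed

end
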